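(* Let $M = K_{5,5}\setminus C_{10}$ be the complete bipartite graph $K_{5,5}$ with the edges of a Hamiltonian cycle removed, and let $M^2$ be the graph obtained from two vertex-disjoint copies of $M$ by identifying the two copies of one side of the bipartition along corresponding vertices (since $M$ is vertex-transitive, the choice of side does not matter). Let $F_{5,3}$ be the bipartite graph with vertex set $[5]\cup\binom{[5]}{3}$ in which $a\in[5]$ is adjacent to $T\in\binom{[5]}{3}$ if and only if $a\in T$. Then, for every graphon $W$, $t_{M^2}(W)\geq t_{F_{5,3}}(W)$.
   Context: A graphon is a symmetric measurable function $W:[0,1]^2\to[0,1]$. For a graph $H$, $t_H(W)=\int_{[0,1]^{V(H)}}\prod_{ij\in E(H)}W(x_i,x_j)\,d\mu^{V(H)}$, where $\mu$ is Lebesgue measure. *)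

theory Defs
  imports "HOL-Analysis.Analysis"
begin

section \<open>Finite simple graphs\<close>

record 'a ugraph =
  verts :: "'a set"
  edges :: "'a set set"

definition simple_graph :: "'a ugraph \<Rightarrow> bool" where
  "simple_graph G \<longleftrightarrow> finite (verts G) \<and> (\<forall>e\<in>edges G. e \<subseteq> verts G \<and> card e = 2)"

definition remove_edges :: "'a ugraph \<Rightarrow> 'a set set \<Rightarrow> 'a ugraph" where
  "remove_edges G C = \<lparr>verts = verts G, edges = edges G - C\<rparr>"

text \<open>A Hamiltonian cycle is represented by its edge set.\<close>

definition hamiltonian_cycle :: "'a ugraph \<Rightarrow> 'a set set \<Rightarrow> bool" where
  "hamiltonian_cycle G C \<longleftrightarrow>
     (\<exists>vs. distinct vs \<and> set vs = verts G \<and> length vs \<ge> 3 \<and>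
           C = {{vs ! i, vs ! (Suc i mod length vs)} | i. i < length vs} \<and> C \<subseteq> edges G)"

definition complete_bipartite :: "nat \<Rightarrow> nat \<Rightarrow> (nat + nat) ugraph" where
  "complete_bipartite m n =
     \<lparr>verts = Inl ` {1..m} \<union> Inr ` {1..n},
      edges = {{Inl i, Inr j} | i j. i \<in> {1..m} \<and> j \<in> {1..n}}\<rparr>"

text \<open>Two copies of \<open>G\<close>, indexed by the two truth values, in which the two copies of each vertex
  of \<open>A\<close> are identified. The common copy of \<open>v \<in> A\<close> is \<open>(v, False)\<close>.\<close>

definition copy_vertex :: "'a set \<Rightarrow> bool \<Rightarrow> 'a \<Rightarrow> 'a \<times> bool" where
  "copy_vertex A k v = (v, if v \<in> A then False else k)"

definition double_along :: "'a set \<Rightarrow> 'a ugraph \<Rightarrow> ('a \<times> bool) ugraph" where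
  "double_along A G =
     \<lparr>verts = (\<Union>k. copy_vertex A k ` verts G),
      edges = (\<Union>k. (`) (copy_vertex A k) ` edges G)\<rparr>"

definition subset_incidence_graph :: "nat \<Rightarrow> nat \<Rightarrow> (nat + nat set) ugraph" where
  "subset_incidence_graph n k =
     \<lparr>verts = Inl ` {1..n} \<union> Inr ` {T. T \<subseteq> {1..n} \<and> card T = k},
      edges = {{Inl a, Inr T} | a T. a \<in> {1..n} \<and> T \<subseteq> {1..n} \<and> card T = k \<and> a \<in> T}\<rparr>"


section \<open>Graphons and homomorphism densities\<close>

text \<open>Only the values on the unit square are constrained, and only those enter the densities.\<close>

definition graphon :: "(real \<times> real \<Rightarrow> real) \<Rightarrow> bool" where
  "graphon W \<longleftrightarrow>
     W \<in> borel_measurable (lebesgue_on ({0..1} \<times> {0..1})) \<and>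
     (\<forall>x\<in>{0..1}. \<forall>y\<in>{0..1}. W (x, y) = W (y, x) \<and> W (x, y) \<in> {0..1})"

text \<open>The factor \<open>W (x i, x j)\<close> of an unordered edge \<open>{i, j}\<close>; the description is unique
  by the symmetry of \<open>W\<close>.\<close>

definition edge_weight :: "(real \<times> real \<Rightarrow> real) \<Rightarrow> ('a \<Rightarrow> real) \<Rightarrow> 'a set \<Rightarrow> real" where
  "edge_weight W x e = (THE w. \<exists>i j. e = {i, j} \<and> w = W (x i, x j))"

text \<open>The completion turns the product of Borel measures into Lebesgue measure on the cube. It is
  needed because \<open>W\<close> is Lebesgue measurable but not necessarily Borel measurable.\<close>

definition unit_cube_measure :: "'a set \<Rightarrow> ('a \<Rightarrow> real) measure" where
  "unit_cube_measure V = completion (Pi\<^sub>M V (\<lambda>_. restrict_space lborel {0..1}))"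

definition hom_density :: "'a ugraph \<Rightarrow> (real \<times> real \<Rightarrow> real) \<Rightarrow> real" where
  "hom_density H W = (\<integral>x. (\<Prod>e\<in>edges H. edge_weight W x e) \<partial>unit_cube_measure (verts H))"


section \<open>Basic checks\<close>

lemma edge_weight_eq:
  assumes "graphon W" "x i \<in> {0..1}" "x j \<in> {0..1}"
  shows "edge_weight W x {i, j} = W (x i, x j)"
  unfolding edge_weight_def
proof (rule the_equality)
  fix w assume "\<exists>i' j'. {i, j} = {i', j'} \<and> w = W (x i', x j')"
  then show "w = W (x i, x j)"
    using assms by (auto simp: graphon_def doubleton_eq_iff)
qed blast

lemma simple_graph_complete_bipartite: "simple_graph (complete_bipartite m n)"
  by (auto simp: simple_graph_def complete_bipartite_def)

lemma simple_graph_remove_edges: "simple_graph G \<Longrightarrow> simple_graph (remove_edges G C)"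
  by (auto simp: simple_graph_def remove_edges_def)

lemma simple_graph_double_along:
  assumes "simple_graph G"
  shows "simple_graph (double_along A G)"
proof -
  have inj: "inj_on (copy_vertex A k) e" for k e
    by (auto simp: inj_on_def copy_vertex_def)
  show ?thesis
    using assms unfolding simple_graph_def double_along_def
    by (auto simp: card_image[OF inj]) 
qed

lemma simple_graph_subset_incidence_graph: "simple_graph (subset_incidence_graph n k)"
  by (auto simp: simple_graph_def subset_incidence_graph_def)

lemma hamiltonian_cycle_complete_bipartite_5_5:
  "\<exists>C. hamiltonian_cycle (complete_bipartite 5 5) C"
proof -
  let ?vs = "[Inl 1, Inr 1, Inl 2, Inr 2, Inl 3, Inr 3, Inl 4, Inr 4, Inl 5, Inr 5] :: (nat + nat) list"
  have 5: "{1..5} = {1, 2, 3, 4, 5 :: nat}" by auto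
  have 10: "i < 10 \<longleftrightarrow> i \<in> {0, 1, 2, 3, 4, 5, 6, 7, 8, 9}" for i :: nat by auto
  have "{{?vs ! i, ?vs ! (Suc i mod 10)} | i. i < 10} \<subseteq> edges (complete_bipartite 5 5)"
    unfolding complete_bipartite_def 5 10 by (auto simp: doubleton_eq_iff)
  then show ?thesis
    unfolding hamiltonian_cycle_def
    by (intro exI[of _ "{{?vs ! i, ?vs ! (Suc i mod 10)} | i. i < 10}"] exI[of _ ?vs])
       (auto simp: complete_bipartite_def 5)
qed

end

theory Submission
  imports Defs "HOL-Probability.Infinite_Product_Measure"
begin

text \<open>
  Integrating out the second side of a bipartite graph writes its density as the integral over the
  first side of a product of codegrees. Along the removed Hamiltonian cycle, label the common side
  cyclically by the residues modulo 5; the neighbourhoods in \<open>M\<close> are then the five cyclic intervals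
  of length 3. If \<open>p\<close> is the product of their codegrees, the density of \<open>M\<^sup>2\<close> is the integral of
  \<open>p\<^sup>2\<close>. The other five triples are the images of these intervals under the permutation
  \<open>i \<mapsto> 2 i\<close> of the residues modulo 5, so the density of \<open>F\<close> is the integral of \<open>p q\<close>, where \<open>q\<close>
  arises from \<open>p\<close> by permuting coordinates and thus has the same \<open>L\<^sup>2\<close>-norm. The Cauchy-Schwarz
  inequality concludes.
\<close>

section \<open>The unit interval as a probability space, its powers, and null sets\<close>

abbreviation unit_measure :: "real measure" where
  "unit_measure \<equiv> restrict_space lborel {0..1}"

lemma prob_space_unit_measure: "prob_space unit_measure"
  by (rule prob_space_restrict_space) auto

interpretation unit_cube: product_prob_space "\<lambda>_. unit_measure" I for I :: "'v set"
  by (rule product_prob_spaceI) (rule prob_space_unit_measure)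

lemma space_unit_measure: "space unit_measure = {0..1}"
  by (simp add: space_restrict_space)

text \<open>Uniqueness of the product measure: the identity map is measurable in both directions, so
  the sigma-algebras agree, and so do the measures of rectangles. This links the product of two unit
  intervals to the square on which graphons are defined.\<close>

lemma pair_measure_restrict_space:
  assumes M: "sigma_finite_measure M" and N: "sigma_finite_measure N"
    and A: "A \<in> sets M" and B: "B \<in> sets N"
  shows "restrict_space M A \<Otimes>\<^sub>M restrict_space N B = restrict_space (M \<Otimes>\<^sub>M N) (A \<times> B)"
    (is "?L = ?R")
proof (rule pair_measure_eqI)
  interpret N: sigma_finite_measure N by fact
  have AB: "A \<inter> space M = A" "B \<inter> space N = B"
    using A B sets.sets_into_space by auto
  show "sigma_finite_measure (restrict_space M A)" "sigma_finite_measure (restrict_space N B)"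
    using sigma_finite_measure_restrict_space[OF M A] sigma_finite_measure_restrict_space[OF N B]
    by auto
  show "sets ?L = sets ?R"
  proof (intro set_eqI iffI)
    fix C assume C: "C \<in> sets ?L"
    have "(\<lambda>x. x) \<in> ?R \<rightarrow>\<^sub>M ?L"
      by (rule measurable_pair) (auto simp: comp_def intro!: measurable_restrict_space3)
    from measurable_sets[OF this C] show "C \<in> sets ?R"
      using sets.sets_into_space[OF C]
      by (simp add: space_restrict_space space_pair_measure AB Times_Int_Times Int_absorb2)
  next
    fix C assume "C \<in> sets ?R"
    then obtain D where D: "D \<in> sets (M \<Otimes>\<^sub>M N)" "C = A \<times> B \<inter> D"
      by (auto simp: sets_restrict_space)
    have "(\<lambda>x. x) \<in> ?L \<rightarrow>\<^sub>M M \<Otimes>\<^sub>M N"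
      by (rule measurable_pair)
         (auto simp: comp_def intro!: measurable_compose[OF measurable_fst measurable_restrict_space1]
           measurable_compose[OF measurable_snd measurable_restrict_space1])
    from measurable_sets[OF this D(1)] show "C \<in> sets ?L"
      using D(2) by (simp add: space_restrict_space space_pair_measure AB Int_commute)
  qed
  fix X Y assume "X \<in> sets (restrict_space M A)" "Y \<in> sets (restrict_space N B)"
  then have XY: "X \<in> sets M" "X \<subseteq> A" "Y \<in> sets N" "Y \<subseteq> B"
    using A B by (auto simp: sets_restrict_space_iff)
  have "emeasure ?R (X \<times> Y) = emeasure (M \<Otimes>\<^sub>M N) (X \<times> Y)"
    using A B XY by (intro emeasure_restrict_space) auto
  then show "emeasure (restrict_space M A) X * emeasure (restrict_space N B) Y = emeasure ?R (X \<times> Y)"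
    using A B XY by (simp add: emeasure_restrict_space N.emeasure_pair_measure_Times)
qed

lemma unit_measure_pair:
  "unit_measure \<Otimes>\<^sub>M unit_measure = restrict_space lborel ({0..1} \<times> {0..1})"
  by (simp add: pair_measure_restrict_space lborel.sigma_finite_measure_axioms lborel_prod)

text \<open>Preimages under \<open>f\<close> and \<open>g\<close> agree up to a null set, which the
  completion absorbs. This makes the integrand built from a merely Lebesgue measurable
  \<open>W\<close> measurable on the completed cube.\<close>

lemma borel_measurable_completion_AE:
  fixes f g :: "'a \<Rightarrow> 'b::topological_space"
  assumes g: "g \<in> borel_measurable M" and ae: "AE x in M. f x = g x"
  shows "f \<in> borel_measurable (completion M)"
proof (rule measurableI)
  fix B :: "'b set" assume "B \<in> sets borel"
  then have "g -` B \<inter> space (completion M) \<in> sets (completion M)"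
    using measurable_sets[OF g] by auto
  then show "f -` B \<inter> space (completion M) \<in> sets (completion M)"
    by (rule complete_measure.in_sets_AE[OF completion.complete_measure_axioms, rotated]) (use AE_completion[OF ae] in \<open>auto elim: AE_mp\<close>)
qed simp

text \<open>The binary product is the image of the product indexed by \<open>bool\<close>, and the
  latter is the image of the big product under reindexing along \<open>case_bool i j\<close>, which
  is injective because \<open>i\<close> and \<open>j\<close> differ. Hence a null set of the square
  pulls back to a null set of the cube.\<close>

lemma distr_PiM_pair:
  assumes M: "prob_space M" and ij: "i \<in> V" "j \<in> V" "i \<noteq> j"
  shows "distr (\<Pi>\<^sub>M v\<in>V. M) (M \<Otimes>\<^sub>M M) (\<lambda>x. (x i, x j)) = M \<Otimes>\<^sub>M M"
proof -
  interpret prob_space M by fact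
  let ?P = "\<Pi>\<^sub>M b\<in>(UNIV :: bool set). M"
  let ?r = "\<lambda>x. \<lambda>b\<in>UNIV. x (case_bool i j b)"
  have cb: "case_bool M M = (\<lambda>_. M)"
    by (auto split: bool.split)
  have r: "distr (\<Pi>\<^sub>M v\<in>V. M) ?P ?r = ?P"
    by (rule distr_PiM_reindex) (use M ij in \<open>auto simp: inj_on_def split: bool.splits\<close>)
  have "M \<Otimes>\<^sub>M M = distr ?P (M \<Otimes>\<^sub>M M) (\<lambda>x. (x True, x False))"
    using pair_measure_eq_distr_PiM[OF sigma_finite_measure_axioms sigma_finite_measure_axioms]
    by (simp add: cb)
  also have "\<dots> = distr (distr (\<Pi>\<^sub>M v\<in>V. M) ?P ?r) (M \<Otimes>\<^sub>M M) (\<lambda>x. (x True, x False))"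
    by (simp add: r)
  also have "\<dots> = distr (\<Pi>\<^sub>M v\<in>V. M) (M \<Otimes>\<^sub>M M) ((\<lambda>x. (x True, x False)) \<circ> ?r)"
  proof (rule distr_distr)
    show "?r \<in> (\<Pi>\<^sub>M v\<in>V. M) \<rightarrow>\<^sub>M ?P"
      by (rule measurable_restrict) (use ij in \<open>auto split: bool.split\<close>)
  qed simp
  finally show ?thesis
    by (simp add: comp_def)
qed

text \<open>Extended by 0 to the plane, \<open>W\<close> is Lebesgue measurable and so almost
  everywhere equal to a Borel function. The result need not be symmetric, so every later factor
  keeps the vertex of the first side as the first argument.\<close>

lemma graphon_borel_version:
  assumes "graphon W"
  obtains W' where "W' \<in> borel_measurable borel" "\<And>p. 0 \<le> W' p" "\<And>p. W' p \<le> 1"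
    "AE p in unit_measure \<Otimes>\<^sub>M unit_measure. W p = W' p"
proof -
  let ?S = "{0..1} \<times> {0..1} :: (real \<times> real) set"
  have S: "?S \<in> sets lborel"
    by (simp add: borel_closed closed_Times)
  have "(\<lambda>p. if p \<in> ?S then W p else 0) \<in> borel_measurable (completion lborel)"
    using assms S by (subst borel_measurable_if) (auto simp: graphon_def)
  then obtain V where V: "V \<in> borel_measurable lborel"
      and ae: "AE p in lborel. (if p \<in> ?S then W p else 0) = V p"
    by (blast dest: completion_ex_borel_measurable_real)
  show ?thesis
  \<comment> \<open>Clamping to [0,1] gives the bounds at every point and changes no value at which
    \<open>V\<close> agrees with \<open>W\<close> on the square.\<close>
  proof (rule that[of "\<lambda>p. max 0 (min 1 (V p))"])
    show "(\<lambda>p. max 0 (min 1 (V p))) \<in> borel_measurable borel"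
      using V by simp
    have "AE p in restrict_space lborel ?S. W p = max 0 (min 1 (V p))"
    proof (subst AE_restrict_space_iff)
      show "AE p in lborel. p \<in> ?S \<longrightarrow> W p = max 0 (min 1 (V p))"
        using ae
      proof eventually_elim
        case (elim p)
        have "0 \<le> W p \<and> W p \<le> 1" if "p \<in> ?S"
          using assms that by (cases p) (auto simp: graphon_def)
        with elim show ?case
          by auto
      qed
    qed (use S in simp)
    then show "AE p in unit_measure \<Otimes>\<^sub>M unit_measure. W p = max 0 (min 1 (V p))"
      unfolding unit_measure_pair .
  qed auto
qed

section \<open>Codegrees and the density of a bipartite graph\<close>

text \<open>For a 0-1-valued \<open>W\<close> this is the measure of the common neighbourhood of the
  points \<open>x i\<close> with \<open>i\<close> in \<open>T\<close>.\<close>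

definition codegree :: "(real \<times> real \<Rightarrow> real) \<Rightarrow> 'i set \<Rightarrow> ('i \<Rightarrow> real) \<Rightarrow> real" where
  "codegree W T x = (\<integral>u. (\<Prod>i\<in>T. W (x i, u)) \<partial>unit_measure)"

lemma AE_unit_cube_pair:
  assumes "AE p in unit_measure \<Otimes>\<^sub>M unit_measure. P p" and "i \<in> V" "j \<in> V" "i \<noteq> j"
  shows "AE x in \<Pi>\<^sub>M v\<in>V. unit_measure. P (x i, x j)"
proof -
  have m: "(\<lambda>x. (x i, x j)) \<in> (\<Pi>\<^sub>M v\<in>V. unit_measure) \<rightarrow>\<^sub>M unit_measure \<Otimes>\<^sub>M unit_measure"
    using assms by measurable
  show ?thesis
    using assms(1)
    by (subst (asm) distr_PiM_pair[OF prob_space_unit_measure assms(2-4), symmetric])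
       (rule AE_distrD[OF m])
qed

text \<open>Here the Borel version pays off: composing a merely Lebesgue measurable function with a
  measurable map can destroy measurability.\<close>

lemma borel_measurable_unit_pair:
  fixes W' :: "real \<times> real \<Rightarrow> real"
  assumes W': "W' \<in> borel_measurable borel"
    and f: "f \<in> M \<rightarrow>\<^sub>M unit_measure" and g: "g \<in> M \<rightarrow>\<^sub>M unit_measure"
  shows "(\<lambda>x. W' (f x, g x)) \<in> borel_measurable M"
proof -
  have "(\<lambda>x. x) \<in> unit_measure \<rightarrow>\<^sub>M borel"
    by (rule measurable_restrict_space1) simp
  from measurable_compose[OF f this] measurable_compose[OF g this]
  have "f \<in> borel_measurable M" "g \<in> borel_measurable M"
    by simp_all
  from measurable_compose[OF borel_measurable_Pair[OF this] W']
  show ?thesis .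
qed

lemma codegree_borel_measurable:
  assumes W': "W' \<in> borel_measurable borel" and "T \<subseteq> I"
  shows "codegree W' T \<in> borel_measurable (\<Pi>\<^sub>M i\<in>I. unit_measure)"
  unfolding codegree_def
proof (rule unit_cube.M.borel_measurable_lebesgue_integral)
  show "(\<lambda>(x, u). \<Prod>i\<in>T. W' (x i, u)) \<in> borel_measurable ((\<Pi>\<^sub>M i\<in>I. unit_measure) \<Otimes>\<^sub>M unit_measure)"
    unfolding case_prod_beta
  proof (intro borel_measurable_prod borel_measurable_unit_pair[OF W'])
    fix i assume "i \<in> T"
    then have "i \<in> I"
      using assms(2) by auto
    then show "(\<lambda>p. fst p i) \<in> (\<Pi>\<^sub>M i\<in>I. unit_measure) \<Otimes>\<^sub>M unit_measure \<rightarrow>\<^sub>M unit_measure"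
      by measurable
  qed simp
qed

lemma codegree_bounds:
  assumes "\<And>p. 0 \<le> W' p" "\<And>p. W' p \<le> 1"
  shows "0 \<le> codegree W' T x" "codegree W' T x \<le> 1"
proof -
  show "0 \<le> codegree W' T x"
    unfolding codegree_def by (intro integral_nonneg_AE AE_I2 prod_nonneg) (use assms in auto)
  have "codegree W' T x \<le> (\<integral>u. 1 \<partial>unit_measure)"
    unfolding codegree_def
    by (intro integral_mono_AE' AE_I2 prod_le_1 prod_nonneg) (use assms in auto)
  then show "codegree W' T x \<le> 1"
    using unit_cube.M.prob_space by simp
qed

lemma codegree_cong: "(\<And>i. i \<in> T \<Longrightarrow> x i = y i) \<Longrightarrow> codegree W T x = codegree W T y"
  by (simp add: codegree_def cong: prod.cong)

lemma codegree_image: "inj_on f T \<Longrightarrow> codegree W (f ` T) x = codegree W T (\<lambda>i. x (f i))"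
  by (simp add: codegree_def prod.reindex)

text \<open>All coordinates carry the same probability measure, so selecting coordinates along an
  injection maps one product measure to the other. It serves both to pass from vertices to labels
  and to permute the coordinates of a cube.\<close>

lemma integral_unit_cube_reindex:
  fixes F :: "('i \<Rightarrow> real) \<Rightarrow> real"
  assumes f: "inj_on f I" "f ` I \<subseteq> K"
    and F: "F \<in> borel_measurable (\<Pi>\<^sub>M i\<in>I. unit_measure)"
  shows "(\<integral>x. F (\<lambda>i\<in>I. x (f i)) \<partial>(\<Pi>\<^sub>M v\<in>K. unit_measure)) = (\<integral>x. F x \<partial>(\<Pi>\<^sub>M i\<in>I. unit_measure))"
proof -
  have r: "distr (\<Pi>\<^sub>M v\<in>K. unit_measure) (\<Pi>\<^sub>M i\<in>I. unit_measure) (\<lambda>x. \<lambda>i\<in>I. x (f i))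
      = (\<Pi>\<^sub>M i\<in>I. unit_measure)"
    by (rule distr_PiM_reindex) (use f prob_space_unit_measure in auto)
  have m: "(\<lambda>x. \<lambda>i\<in>I. x (f i)) \<in> (\<Pi>\<^sub>M v\<in>K. unit_measure) \<rightarrow>\<^sub>M (\<Pi>\<^sub>M i\<in>I. unit_measure)"
    by (rule measurable_restrict) (use f in auto)
  show ?thesis
    using integral_distr[OF m F] by (simp only: r)
qed

text \<open>Fubini: once the first side is fixed, the integrand splits into factors that each depend
  on a single vertex of the second side, and each factor integrates to a codegree. The maps
  \<open>f\<close> and \<open>g\<close> label the two sides, which frees the formula from the vertex
  type of \<open>H\<close>; \<open>S j\<close> is the neighbourhood of \<open>g j\<close> in terms
  of labels.\<close>

lemma hom_density_bipartite:
  fixes f :: "'i \<Rightarrow> 'v" and g :: "'j \<Rightarrow> 'v"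
  assumes fin: "finite I" "finite J"
    and inj: "inj_on f I" "inj_on g J" and disj: "f ` I \<inter> g ` J = {}"
    and verts: "verts H = f ` I \<union> g ` J"
    and edges: "edges H = {{f i, g j} | i j. j \<in> J \<and> i \<in> S j}"
    and S: "\<And>j. j \<in> J \<Longrightarrow> S j \<subseteq> I"
    and W: "graphon W"
    and W': "W' \<in> borel_measurable borel" "\<And>p. 0 \<le> W' p" "\<And>p. W' p \<le> 1"
    and ae: "AE p in unit_measure \<Otimes>\<^sub>M unit_measure. W p = W' p"
  shows "hom_density H W = (\<integral>x. (\<Prod>j\<in>J. codegree W' (S j) x) \<partial>(\<Pi>\<^sub>M i\<in>I. unit_measure))"
proof -
  let ?V = "f ` I \<union> g ` J"
  let ?P = "\<lambda>V. \<Pi>\<^sub>M v\<in>V. unit_measure"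
  let ?h = "\<lambda>x. \<Prod>j\<in>J. \<Prod>i\<in>S j. W' (x (f i), x (g j))"
  let ?w = "\<lambda>x. \<Prod>e\<in>edges H. edge_weight W x e"
  let ?E = "Sigma J S"
  have finS: "finite (S j)" if "j \<in> J" for j
    using fin(1) S[OF that] by (rule finite_subset[rotated])
  have finE: "finite ?E"
    using fin finS by auto
  have edges': "edges H = (\<lambda>(j, i). {f i, g j}) ` ?E"
    by (auto simp: edges)
  \<comment> \<open>Disjointness of the sides rules out matching two edges with their ends swapped,
    so the product over the edge set has one factor for each pair \<open>(j, i)\<close>.\<close>
  have inj_edge: "inj_on (\<lambda>(j, i). {f i, g j}) ?E"
  proof (rule inj_onI, clarify)
    fix j i j' i'
    assume *: "j \<in> J" "i \<in> S j" "j' \<in> J" "i' \<in> S j'" "{f i, g j} = {f i', g j'}"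
    then have mem: "i \<in> I" "i' \<in> I"
      using S by auto
    then have "f i \<noteq> g j'" "f i' \<noteq> g j"
      using * disj by auto
    then have "f i = f i'" "g j = g j'"
      using *(5) by (auto simp: doubleton_eq_iff)
    then show "j = j' \<and> i = i'"
      using * mem inj by (auto dest: inj_onD)
  qed
  have w_eq: "?w x = (\<Prod>(j, i)\<in>?E. W (x (f i), x (g j)))" if "x \<in> space (?P ?V)" for x
  proof -
    have x: "x v \<in> {0..1}" if "v \<in> ?V" for v
      using \<open>x \<in> space (?P ?V)\<close> that by (auto simp: space_PiM PiE_iff space_unit_measure simp del: atLeastAtMost_iff)
    have "?w x = (\<Prod>(j, i)\<in>?E. edge_weight W x {f i, g j})"
      unfolding edges' by (subst prod.reindex[OF inj_edge]) (simp add: case_prod_beta)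
    also have "\<dots> = (\<Prod>(j, i)\<in>?E. W (x (f i), x (g j)))"
      by (intro prod.cong refl, clarify, rule edge_weight_eq[OF W]; rule x) (use S in auto)
    finally show ?thesis .
  qed
  \<comment> \<open>There are finitely many edges, each with ends in different sides, so the
    exceptional null sets can be united.\<close>
  have "AE x in ?P ?V. \<forall>e\<in>?E. W (x (f (snd e)), x (g (fst e))) = W' (x (f (snd e)), x (g (fst e)))"
  proof (rule AE_finite_allI[OF finE])
    fix e assume "e \<in> ?E"
    then have "f (snd e) \<in> f ` I" "g (fst e) \<in> g ` J"
      using S by fastforce+
    then show "AE x in ?P ?V. W (x (f (snd e)), x (g (fst e))) = W' (x (f (snd e)), x (g (fst e)))"
      using disj by (intro AE_unit_cube_pair[OF ae]) (blast, blast, metis disjoint_iff)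
  qed
  then have ae': "AE x in ?P ?V. ?w x = ?h x"
  proof (rule AE_mp, intro AE_I2 impI)
    fix x assume x: "x \<in> space (?P ?V)"
      and eq: "\<forall>e\<in>?E. W (x (f (snd e)), x (g (fst e))) = W' (x (f (snd e)), x (g (fst e)))"
    have "?w x = (\<Prod>(j, i)\<in>?E. W' (x (f i), x (g j)))"
      unfolding w_eq[OF x] using eq by (intro prod.cong) auto
    then show "?w x = ?h x"
      using fin finS by (simp add: prod.Sigma)
  qed
  have comp: "(\<lambda>x. x v) \<in> ?P ?V \<rightarrow>\<^sub>M unit_measure" if "v \<in> ?V" for v
    using that by (rule measurable_component_singleton)
  have h: "?h \<in> borel_measurable (?P ?V)"
    by (intro borel_measurable_prod borel_measurable_unit_pair[OF W'(1)] comp) (use S in auto)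
  have h_int: "integrable (?P ?V) ?h"
    by (rule unit_cube.P.integrable_const_bound[where B = 1, OF AE_I2 h])
       (auto simp: abs_prod W' intro!: prod_le_1 prod_nonneg)
  have u_int: "integrable unit_measure (\<lambda>u. \<Prod>i\<in>T. W' (x i, u))"
    if "T \<subseteq> I" "x \<in> space (?P I)" for T and x :: "'i \<Rightarrow> real"
  proof (rule unit_cube.M.integrable_const_bound[where B = 1, OF AE_I2])
    show "(\<lambda>u. \<Prod>i\<in>T. W' (x i, u)) \<in> borel_measurable unit_measure"
    proof (intro borel_measurable_prod borel_measurable_unit_pair[OF W'(1)])
      fix i assume "i \<in> T"
      then have "x i \<in> space unit_measure"
        using that by (auto simp: space_PiM PiE_iff)
      then show "(\<lambda>u. x i) \<in> unit_measure \<rightarrow>\<^sub>M unit_measure"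
        by (rule measurable_const)
    qed simp
  qed (auto simp: abs_prod W' intro!: prod_le_1 prod_nonneg)
  have prod_meas: "(\<lambda>x. \<Prod>j\<in>J. codegree W' (S j) x) \<in> borel_measurable (?P I)"
    using S by (intro borel_measurable_prod codegree_borel_measurable[OF W'(1)])
  have "hom_density H W = (\<integral>x. ?w x \<partial>completion (?P ?V))"
    by (simp add: hom_density_def unit_cube_measure_def verts)
  \<comment> \<open>The integrand is first exchanged for \<open>?h\<close> under the completed
    measure; as \<open>?h\<close> is measurable for the product measure itself, the completion can
    then be dropped.\<close>
  also have "\<dots> = (\<integral>x. ?h x \<partial>completion (?P ?V))"
    by (rule integral_cong_AE[OF borel_measurable_completion_AE[OF h ae'] measurable_completion[OF h]
        AE_completion[OF ae']])
  also have "\<dots> = (\<integral>x. ?h x \<partial>?P ?V)"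
    by (rule integral_completion[OF h])
  also have "\<dots> = (\<integral>x. (\<integral>y. ?h (merge (f ` I) (g ` J) (x, y)) \<partial>?P (g ` J)) \<partial>?P (f ` I))"
    using fin disj by (intro unit_cube.product_integral_fold[OF _ _ _ h_int]) auto
  also have "\<dots> = (\<integral>x. (\<Prod>j\<in>J. codegree W' (S j) (\<lambda>i\<in>I. x (f i))) \<partial>?P (f ` I))"
  proof (rule Bochner_Integration.integral_cong[OF refl])
    fix x assume x: "x \<in> space (?P (f ` I))"
    have xf: "(\<lambda>i\<in>I. x (f i)) \<in> space (?P I)"
      using x by (auto simp: space_PiM PiE_iff)
    \<comment> \<open>The integral of a product of one-variable functions is indexed by the
      coordinates \<open>v\<close>, so the label of \<open>v\<close> has to be recovered by
      inverting \<open>g\<close>.\<close>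
    let ?k = "\<lambda>v u. \<Prod>i\<in>S (the_inv_into J g v). W' (x (f i), u)"
    have k: "?k (g j) u = (\<Prod>i\<in>S j. W' ((\<lambda>i\<in>I. x (f i)) i, u))" if "j \<in> J" for j u
      using that S[OF that] inj(2) by (auto simp: the_inv_into_f_f intro!: prod.cong)
    have "?h (merge (f ` I) (g ` J) (x, y)) = (\<Prod>v\<in>g ` J. ?k v (y v))" for y
    proof -
      have "?h (merge (f ` I) (g ` J) (x, y)) = (\<Prod>j\<in>J. \<Prod>i\<in>S j. W' (x (f i), y (g j)))"
      proof (intro prod.cong refl)
        fix j i assume "j \<in> J" "i \<in> S j"
        then have "f i \<in> f ` I" "g j \<in> g ` J" "g j \<notin> f ` I"
          using S disj by blast+
        then show "W' (merge (f ` I) (g ` J) (x, y) (f i), merge (f ` I) (g ` J) (x, y) (g j))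
            = W' (x (f i), y (g j))"
          by (simp add: merge_def)
      qed
      also have "\<dots> = (\<Prod>v\<in>g ` J. ?k v (y v))"
        using inj(2) by (simp add: prod.reindex the_inv_into_f_f)
      finally show ?thesis .
    qed
    then have "(\<integral>y. ?h (merge (f ` I) (g ` J) (x, y)) \<partial>?P (g ` J))
        = (\<integral>y. (\<Prod>v\<in>g ` J. ?k v (y v)) \<partial>?P (g ` J))"
      by simp
    also have "\<dots> = (\<Prod>v\<in>g ` J. integral\<^sup>L unit_measure (?k v))"
    proof (rule unit_cube.product_integral_prod)
      fix v assume "v \<in> g ` J"
      then obtain j where j: "j \<in> J" "v = g j"
        by auto
      show "integrable unit_measure (?k v)"
        unfolding j(2) k[OF j(1)] using S[OF j(1)] xf by (rule u_int)
    qed (use fin in simp)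
    also have "\<dots> = (\<Prod>j\<in>J. codegree W' (S j) (\<lambda>i\<in>I. x (f i)))"
      unfolding prod.reindex[OF inj(2)] comp_def codegree_def by (intro prod.cong refl) (simp add: k)
    finally show "(\<integral>y. ?h (merge (f ` I) (g ` J) (x, y)) \<partial>?P (g ` J))
        = (\<Prod>j\<in>J. codegree W' (S j) (\<lambda>i\<in>I. x (f i)))" .
  qed
  also have "\<dots> = (\<integral>x. (\<Prod>j\<in>J. codegree W' (S j) x) \<partial>?P I)"
    by (rule integral_unit_cube_reindex[OF inj(1) order_refl prod_meas])
  finally show ?thesis .
qed


section \<open>The Cauchy-Schwarz inequality\<close>

text \<open>For functions of equal norm, Cauchy-Schwarz is the integrated form of the inequality
  \<open>2 * F x * G x \<le> (F x)\<^sup>2 + (G x)\<^sup>2\<close>.\<close>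

lemma integral_mult_le_integral_square:
  fixes F G :: "'a \<Rightarrow> real"
  assumes "integrable M (\<lambda>x. (F x)\<^sup>2)" "integrable M (\<lambda>x. (G x)\<^sup>2)" "integrable M (\<lambda>x. F x * G x)"
    and eq: "(\<integral>x. (G x)\<^sup>2 \<partial>M) = (\<integral>x. (F x)\<^sup>2 \<partial>M)"
  shows "(\<integral>x. F x * G x \<partial>M) \<le> (\<integral>x. (F x)\<^sup>2 \<partial>M)"
proof -
  have "(\<integral>x. F x * G x \<partial>M) \<le> (\<integral>x. ((F x)\<^sup>2 + (G x)\<^sup>2) / 2 \<partial>M)"
  proof (rule integral_mono)
    fix x
    show "F x * G x \<le> ((F x)\<^sup>2 + (G x)\<^sup>2) / 2"
      using sum_squares_bound[of "F x" "G x"] by (simp add: field_simps)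
  qed (use assms in auto)
  also have "\<dots> = (\<integral>x. (F x)\<^sup>2 \<partial>M)"
    using assms by simp
  finally show ?thesis .
qed

section \<open>The ten triples of residues modulo 5\<close>

text \<open>The removed pair consists of the two cycle neighbours of the \<open>j\<close>-th vertex
  of the other side; what remains is the interval j+2, j+3, j+4 modulo 5.\<close>

definition cyclic_triple :: "nat \<Rightarrow> nat set" where
  "cyclic_triple j = {..<5} - {j, Suc j mod 5}"

text \<open>Doubling carries the pentagon to the pentagram: complements of pairs at cyclic distance
  1 become complements of pairs at distance 2.\<close>

definition double5 :: "nat \<Rightarrow> nat" where
  "double5 i = 2 * i mod 5"

lemma lessThan_5: "{..<5} = {0, 1, 2, 3, 4 :: nat}"
  by auto

lemma cyclic_triple_subset: "cyclic_triple j \<subseteq> {..<5}"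
  by (auto simp: cyclic_triple_def)

lemma card_cyclic_triple: "j < 5 \<Longrightarrow> card (cyclic_triple j) = 3"
  unfolding cyclic_triple_def by (subst card_Diff_subset) (auto simp: card_insert_if mod_Suc)

lemma inj_on_cyclic_triple: "inj_on cyclic_triple {..<5}"
proof (rule inj_onI)
  fix j k :: nat
  assume "j \<in> {..<5}" "k \<in> {..<5}" and eq: "cyclic_triple j = cyclic_triple k"
  then have "j \<in> {0, 1, 2, 3, 4}" "k \<in> {0, 1, 2, 3, 4}"
    by auto
  then show "j = k"
    using eq
    by (elim insertE emptyE)
       (simp_all add: cyclic_triple_def lessThan_5 set_eq_subset insert_Diff_if)
qed

lemma inj_on_double5: "inj_on double5 {..<5}"
  unfolding lessThan_5 by (simp add: inj_on_insert double5_def)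

lemma double5_image: "double5 ` {..<5} = {..<5}"
  unfolding double5_def lessThan_5 by auto

lemma double5_cyclic_triple_subset: "double5 ` cyclic_triple j \<subseteq> {..<5}"
  using image_mono[OF cyclic_triple_subset] double5_image by metis

lemma inj_on_double5_cyclic_triple: "inj_on (\<lambda>j. double5 ` cyclic_triple j) {..<5}"
proof (rule inj_onI)
  fix j k assume *: "j \<in> {..<5}" "k \<in> {..<5}" "double5 ` cyclic_triple j = double5 ` cyclic_triple k"
  then have "cyclic_triple j = cyclic_triple k"
    using inj_on_image_eq_iff[OF inj_on_double5 cyclic_triple_subset cyclic_triple_subset] by blast
  then show "j = k"
    using inj_on_cyclic_triple * by (auto dest: inj_onD)
qed

text \<open>The complementary pairs have cyclic distance 1 on the left and 2 on the right; the proof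
  checks all 25 cases.\<close>

lemma cyclic_triple_neq_double5_cyclic_triple:
  assumes "j < 5" "k < 5"
  shows "cyclic_triple j \<noteq> double5 ` cyclic_triple k"
proof -
  have "j \<in> {0, 1, 2, 3, 4}" "k \<in> {0, 1, 2, 3, 4}"
    using assms by auto
  then show ?thesis
    by (elim insertE emptyE)
       (simp_all add: cyclic_triple_def lessThan_5 double5_def set_eq_subset insert_Diff_if)
qed

text \<open>By counting: the two families are disjoint with five members each, and there are ten
  triples in all.\<close>

lemma triples_eq:
  "{T. T \<subseteq> {..<5 :: nat} \<and> card T = 3} = cyclic_triple ` {..<5} \<union> (\<lambda>j. double5 ` cyclic_triple j) ` {..<5}"
proof (rule card_subset_eq[symmetric])
  have "card (double5 ` cyclic_triple j) = 3" if "j < 5" for j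
    using card_cyclic_triple[OF that] card_image[OF inj_on_subset[OF inj_on_double5 cyclic_triple_subset]] by simp
  then show "cyclic_triple ` {..<5} \<union> (\<lambda>j. double5 ` cyclic_triple j) ` {..<5} \<subseteq> {T. T \<subseteq> {..<5} \<and> card T = 3}"
    using cyclic_triple_subset double5_cyclic_triple_subset by (simp add: image_subset_iff card_cyclic_triple)
  have "card (cyclic_triple ` {..<5} \<union> (\<lambda>j. double5 ` cyclic_triple j) ` {..<5}) = 10"
    by (subst card_Un_disjoint)
       (auto simp: card_image inj_on_cyclic_triple inj_on_double5_cyclic_triple cyclic_triple_neq_double5_cyclic_triple)
  moreover have "card {T. T \<subseteq> {..<5 :: nat} \<and> card T = 3} = 10"
    by (subst n_subsets) (simp_all add: choose_reduce_nat)
  ultimately show "card (cyclic_triple ` {..<5} \<union> (\<lambda>j. double5 ` cyclic_triple j) ` {..<5})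
      = card {T. T \<subseteq> {..<5 :: nat} \<and> card T = 3}"
    by simp
qed simp

lemma prod_triples:
  fixes F :: "nat set \<Rightarrow> 'a::comm_monoid_mult"
  shows "(\<Prod>T | T \<subseteq> {..<5} \<and> card T = 3. F T)
    = (\<Prod>j<5. F (cyclic_triple j)) * (\<Prod>j<5. F (double5 ` cyclic_triple j))"
proof -
  have "cyclic_triple ` {..<5} \<inter> (\<lambda>j. double5 ` cyclic_triple j) ` {..<5} = {}"
    using cyclic_triple_neq_double5_cyclic_triple by auto
  then have "(\<Prod>T | T \<subseteq> {..<5} \<and> card T = 3. F T)
      = prod F (cyclic_triple ` {..<5}) * prod F ((\<lambda>j. double5 ` cyclic_triple j) ` {..<5})"
    unfolding triples_eq by (intro prod.union_disjoint) auto
  then show ?thesis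
    unfolding prod.reindex[OF inj_on_cyclic_triple] prod.reindex[OF inj_on_double5_cyclic_triple]
    by (simp add: comp_def)
qed

section \<open>Coordinates along a Hamiltonian cycle\<close>

text \<open>The cycle alternates between the sides. Started on the side of \<open>h\<close>, it
  visits \<open>h (\<alpha> i)\<close> at position 2i and \<open>h' (\<beta> j)\<close> at position
  2j+1, whose neighbours sit at 2j and 2j+2. With \<open>h\<close> and \<open>h'\<close> as
  parameters, either side can play the role of the common one.\<close>

lemma hamiltonian_cycle_enumeration:
  fixes h h' :: "nat \<Rightarrow> nat + nat"
  assumes C: "hamiltonian_cycle (complete_bipartite 5 5) C"
    and h: "h = Inl \<and> h' = Inr \<or> h = Inr \<and> h' = Inl"
  obtains \<alpha> \<beta> where "bij_betw \<alpha> {..<5} {1..5}" "bij_betw \<beta> {..<5} {1..5}"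
    "\<And>i j. i < 5 \<Longrightarrow> j < 5 \<Longrightarrow> {h (\<alpha> i), h' (\<beta> j)} \<in> C \<longleftrightarrow> i = j \<or> i = Suc j mod 5"
proof -
  let ?K = "complete_bipartite 5 5"
  obtain vs where vs: "distinct vs" "set vs = verts ?K"
      and C_eq: "C = {{vs ! i, vs ! (Suc i mod length vs)} | i. i < length vs}" and C_sub: "C \<subseteq> edges ?K"
    using C unfolding hamiltonian_cycle_def by blast
  have "card (verts ?K) = 10"
    using card_Plus[of "{1..5::nat}" "{1..5::nat}"] by (simp add: complete_bipartite_def Plus_def)
  then have len: "length vs = 10"
    using vs distinct_card[of vs] by simp
  have verts: "verts ?K = h ` {1..5} \<union> h' ` {1..5}"
    using h by (auto simp: complete_bipartite_def)
  have edge_sides: "u \<in> range h \<longleftrightarrow> v \<notin> range h" if "{u, v} \<in> edges ?K" for u v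
    using that h by (auto simp: complete_bipartite_def doubleton_eq_iff)
  \<comment> \<open>The list may start on either side; rotating it by \<open>s\<close> puts position
    0 on the side of \<open>h\<close>.\<close>
  define s :: nat where "s = (if vs ! 0 \<in> range h then 0 else 1)"
  have s: "s = 0 \<or> s = 1"
    by (simp add: s_def)
  define u where "u i = vs ! ((i + s) mod 10)" for i
  have u_inj: "u i = u j \<longleftrightarrow> i = j" if "i < 10" "j < 10" for i j
  proof -
    have "u i = u j \<longleftrightarrow> (i + s) mod 10 = (j + s) mod 10"
      unfolding u_def using vs len by (simp add: nth_eq_iff_index_eq)
    also have "\<dots> \<longleftrightarrow> i = j"
      using that s by (auto simp: mod_Suc split: if_splits)
    finally show ?thesis .
  qed
  have u_verts: "u i \<in> verts ?K" for i
    unfolding u_def vs(2)[symmetric] using len by (intro nth_mem) simp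
  have u_Suc: "u (Suc i mod 10) = vs ! (Suc ((i + s) mod 10) mod 10)" for i
    unfolding u_def by (simp add: mod_simps)
  have C_u: "C = {{u i, u (Suc i mod 10)} | i. i < 10}"
  proof (intro set_eqI iffI)
    fix e assume "e \<in> C"
    then obtain i where i: "i < 10" "e = {vs ! i, vs ! (Suc i mod 10)}"
      using C_eq len by auto
    \<comment> \<open>This undoes the rotation; adding 10 first avoids truncated subtraction at
      \<open>i = 0\<close>.\<close>
    let ?k = "(i + 10 - s) mod 10"
    have "(?k + s) mod 10 = i"
      using i(1) s by (auto simp: mod_simps)
    then have "e = {u ?k, u (Suc ?k mod 10)}"
      unfolding u_Suc i(2) by (simp add: u_def)
    then show "e \<in> {{u i, u (Suc i mod 10)} | i. i < 10}"
      by force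
  next
    fix e assume "e \<in> {{u i, u (Suc i mod 10)} | i. i < 10}"
    then obtain i where "e = {vs ! ((i + s) mod 10), vs ! (Suc ((i + s) mod 10) mod 10)}"
      by (auto simp: u_Suc) (simp add: u_def)
    then show "e \<in> C"
      unfolding C_eq len by force
  qed
  have step: "u i \<in> range h \<longleftrightarrow> u (Suc i mod 10) \<notin> range h" if "i < 10" for i
    using C_sub that by (intro edge_sides) (auto simp: C_u)
  have u0: "u 0 \<in> range h"
  proof (cases "vs ! 0 \<in> range h")
    case False
    have "{vs ! 0, vs ! (Suc 0 mod 10)} \<in> edges ?K"
      using C_sub unfolding C_eq len by force
    with False show ?thesis
      using edge_sides unfolding u_def s_def by auto
  qed (simp add: u_def s_def)
  have side: "u i \<in> range h \<longleftrightarrow> even i" if "i < 10" for i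
    using that
  proof (induction i)
    case (Suc i)
    then show ?case
      using step[of i] by simp blast
  qed (use u0 in simp)
  define \<alpha> where "\<alpha> i = inv h (u (2 * i))" for i
  define \<beta> where "\<beta> i = inv h' (u (2 * i + 1))" for i
  have h_\<alpha>: "h (\<alpha> i) = u (2 * i)" if "i < 5" for i
    unfolding \<alpha>_def by (rule f_inv_into_f) (use that side[of "2 * i"] in simp)
  have h_\<beta>: "h' (\<beta> i) = u (2 * i + 1)" if "i < 5" for i
    unfolding \<beta>_def
  proof (rule f_inv_into_f)
    have "u (2 * i + 1) \<notin> range h"
      using that side[of "2 * i + 1"] by simp
    then show "u (2 * i + 1) \<in> range h'"
      using u_verts[of "2 * i + 1"] verts by auto
  qed
  have bij: "bij_betw \<gamma> {..<5} {1..5}"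
    if "inj_on \<gamma> {..<5}" "\<gamma> ` {..<5} \<subseteq> {1..5}" for \<gamma> :: "nat \<Rightarrow> nat"
    using that by (simp add: bij_betw_def card_image card_subset_eq)
  show ?thesis
  proof
    show "bij_betw \<alpha> {..<5} {1..5}"
    proof (rule bij)
      show "inj_on \<alpha> {..<5}"
        by (rule inj_onI, drule arg_cong[of _ _ h]) (simp add: h_\<alpha> u_inj)
      show "\<alpha> ` {..<5} \<subseteq> {1..5}"
      proof (rule image_subsetI)
        fix i :: nat assume "i \<in> {..<5}"
        then have "h (\<alpha> i) \<in> h ` {1..5} \<union> h' ` {1..5}"
          using u_verts[of "2 * i"] by (simp add: h_\<alpha> verts)
        then show "\<alpha> i \<in> {1..5}"
          using h by auto
      qed
    qed
    show "bij_betw \<beta> {..<5} {1..5}"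
    proof (rule bij)
      show "inj_on \<beta> {..<5}"
        by (rule inj_onI, drule arg_cong[of _ _ h']) (simp add: h_\<beta> u_inj)
      show "\<beta> ` {..<5} \<subseteq> {1..5}"
      proof (rule image_subsetI)
        fix i :: nat assume "i \<in> {..<5}"
        then have "h' (\<beta> i) \<in> h ` {1..5} \<union> h' ` {1..5}"
          using u_verts[of "2 * i + 1"] by (simp add: h_\<beta> verts)
        then show "\<beta> i \<in> {1..5}"
          using h by auto
      qed
    qed
    fix i j :: nat assume ij: "i < 5" "j < 5"
    have "{h (\<alpha> i), h' (\<beta> j)} \<in> C
        \<longleftrightarrow> (\<exists>k<10. {u (2 * i), u (2 * j + 1)} = {u k, u (Suc k mod 10)})"
      using ij by (auto simp: C_u h_\<alpha> h_\<beta>)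
    also have "\<dots> \<longleftrightarrow> (\<exists>k<10. 2 * i = k \<and> 2 * j + 1 = Suc k mod 10
        \<or> 2 * i = Suc k mod 10 \<and> 2 * j + 1 = k)"
      using ij by (intro ex_cong1 conj_cong refl) (simp add: doubleton_eq_iff u_inj)
    also have "\<dots> \<longleftrightarrow> 2 * j + 1 = Suc (2 * i) mod 10 \<or> 2 * i = Suc (2 * j + 1) mod 10"
    proof -
      have "2 * i < 10" "2 * j + 1 < 10"
        using ij by auto
      then show ?thesis
        by blast
    qed
    \<comment> \<open>Positions modulo 10 halve to indices modulo 5. The successor of 2i never wraps
      around, while that of 2j+1 wraps exactly when j = 4.\<close>
    also have "\<dots> \<longleftrightarrow> i = j \<or> i = Suc j mod 5"
    proof -
      have "Suc (2 * i) mod 10 = 2 * i + 1" "Suc (2 * j + 1) mod 10 = 2 * (Suc j mod 5)"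
        using ij mult_mod_right[of 2 "Suc j" 5] by simp_all
      then show ?thesis
        by auto
    qed
    finally show "{h (\<alpha> i), h' (\<beta> j)} \<in> C \<longleftrightarrow> i = j \<or> i = Suc j mod 5" .
  qed
qed

section \<open>Comparison of the two densities\<close>

theorem theorem2p1:
  fixes W :: "real \<times> real \<Rightarrow> real"
    and C :: "(nat + nat) set set"
    and A :: "(nat + nat) set"
    and M :: "(nat + nat) ugraph"
  assumes "hamiltonian_cycle (complete_bipartite 5 5) C"
    and "M = remove_edges (complete_bipartite 5 5) C"
    and "A = Inl ` {1..5} \<or> A = Inr ` {1..5}"
    and "graphon W"
  shows "hom_density (double_along A M) W \<ge> hom_density (subset_incidence_graph 5 3) W"
proof -
  let ?K = "complete_bipartite 5 5"
  let ?P = "\<Pi>\<^sub>M i\<in>{..<5::nat}. unit_measure"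
  obtain W' where W': "W' \<in> borel_measurable borel" "\<And>p. 0 \<le> W' p" "\<And>p. W' p \<le> 1"
      and ae: "AE p in unit_measure \<Otimes>\<^sub>M unit_measure. W p = W' p"
    by (rule graphon_borel_version[OF assms(4)]) blast
  \<comment> \<open>Both choices of the common side are treated at once, with \<open>h\<close>
    embedding the side \<open>A\<close>.\<close>
  obtain h h' :: "nat \<Rightarrow> nat + nat" where h: "h = Inl \<and> h' = Inr \<or> h = Inr \<and> h' = Inl"
      and A: "A = h ` {1..5}"
    using assms(3) by blast
  obtain \<alpha> \<beta> where \<alpha>: "bij_betw \<alpha> {..<5} {1..5}" and \<beta>: "bij_betw \<beta> {..<5} {1..5}"
      and C_iff: "\<And>i j. i < 5 \<Longrightarrow> j < 5 \<Longrightarrow> {h (\<alpha> i), h' (\<beta> j)} \<in> C \<longleftrightarrow> i = j \<or> i = Suc j mod 5"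
    using hamiltonian_cycle_enumeration[OF assms(1) h] by blast
  have \<alpha>_im: "{1..5} = \<alpha> ` {..<5}" and \<beta>_im: "{1..5} = \<beta> ` {..<5}"
    using \<alpha> \<beta> by (auto simp: bij_betw_def)
  \<comment> \<open>The tag \<open>False\<close> is the one that \<open>copy_vertex\<close> gives to
    identified vertices; a vertex of the other side keeps its copy index \<open>k\<close>.\<close>
  let ?f = "\<lambda>i. (h (\<alpha> i), False)" and ?g = "\<lambda>(j, k). (h' (\<beta> j), k)"
  have copy: "copy_vertex A k (h (\<alpha> i)) = ?f i" "copy_vertex A k (h' (\<beta> i)) = ?g (i, k)"
    if "i < 5" for i k
    using that h unfolding copy_vertex_def A \<alpha>_im by auto
  have K_verts: "verts ?K = h ` \<alpha> ` {..<5} \<union> h' ` \<beta> ` {..<5}"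
    using h unfolding complete_bipartite_def \<alpha>_im[symmetric] \<beta>_im[symmetric] by auto
  have "edges ?K = {{h a, h' b} | a b. a \<in> {1..5} \<and> b \<in> {1..5}}"
    using h unfolding complete_bipartite_def by (auto simp: insert_commute)
  also have "\<dots> = {{h (\<alpha> i), h' (\<beta> j)} | i j. i < 5 \<and> j < 5}"
    by (subst \<alpha>_im, subst \<beta>_im) blast
  finally have K_edges: "edges ?K = {{h (\<alpha> i), h' (\<beta> j)} | i j. i < 5 \<and> j < 5}" .
  have M_edges: "edges M = {{h (\<alpha> i), h' (\<beta> j)} | i j. j < 5 \<and> i \<in> cyclic_triple j}"
  proof -
    have iff: "i < 5 \<and> j < 5 \<and> {h (\<alpha> i), h' (\<beta> j)} \<notin> C \<longleftrightarrow> j < 5 \<and> i \<in> cyclic_triple j" for i j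
      by (auto simp: cyclic_triple_def C_iff)
    have "edges M = {{h (\<alpha> i), h' (\<beta> j)} | i j. i < 5 \<and> j < 5 \<and> {h (\<alpha> i), h' (\<beta> j)} \<notin> C}"
      unfolding assms(2) remove_edges_def K_edges by auto
    then show ?thesis
      by (simp only: iff)
  qed
  \<comment> \<open>The second side of the doubled graph has ten vertices, labelled by pairs
    \<open>(j, k)\<close>; the neighbourhood ignores \<open>k\<close>, so each codegree occurs
    twice.\<close>
  have M2: "hom_density (double_along A M) W
      = (\<integral>x. (\<Prod>j\<in>{..<5} \<times> (UNIV :: bool set). codegree W' (cyclic_triple (fst j)) x) \<partial>?P)"
  proof (rule hom_density_bipartite[where f = ?f and g = ?g, OF _ _ _ _ _ _ _ _ assms(4) W' ae])
    show "inj_on ?f {..<5}" "inj_on ?g ({..<5} \<times> UNIV)"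
      using \<alpha> \<beta> h by (auto simp: bij_betw_def inj_on_def)
    show "?f ` {..<5} \<inter> ?g ` ({..<5} \<times> UNIV) = {}"
      using h by auto
    show "verts (double_along A M) = ?f ` {..<5} \<union> ?g ` ({..<5} \<times> UNIV)"
      unfolding double_along_def assms(2) remove_edges_def
      by (force simp: K_verts copy image_Un image_image)
    have "edges (double_along A M) = {{?f i, ?g (j, k)} | i j k. j < 5 \<and> i \<in> cyclic_triple j}"
    proof -
      have *: "copy_vertex A k ` {h (\<alpha> i), h' (\<beta> j)} = {?f i, ?g (j, k)}"
        if "j < 5" "i \<in> cyclic_triple j" for i j k
        using that cyclic_triple_subset[of j] copy by auto
      show ?thesis
      proof (intro set_eqI iffI)
        fix e assume "e \<in> edges (double_along A M)"
        then obtain i j k where "j < 5" "i \<in> cyclic_triple j" "e = copy_vertex A k ` {h (\<alpha> i), h' (\<beta> j)}"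
          unfolding double_along_def ugraph.simps M_edges by blast
        then show "e \<in> {{?f i, ?g (j, k)} | i j k. j < 5 \<and> i \<in> cyclic_triple j}"
          using * by blast
      next
        fix e assume "e \<in> {{?f i, ?g (j, k)} | i j k. j < 5 \<and> i \<in> cyclic_triple j}"
        then obtain i j k where ij: "j < 5" "i \<in> cyclic_triple j" and "e = {?f i, ?g (j, k)}"
          by blast
        then have "e = copy_vertex A k ` {h (\<alpha> i), h' (\<beta> j)}"
          using * by simp
        then show "e \<in> edges (double_along A M)"
          unfolding double_along_def ugraph.simps M_edges using ij by blast
      qed
    qed
    then show "edges (double_along A M)
        = {{?f i, ?g j} | i j. j \<in> {..<5} \<times> UNIV \<and> i \<in> cyclic_triple (fst j)}"
      by auto
  qed (use cyclic_triple_subset in auto)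
  have F: "hom_density (subset_incidence_graph 5 3) W
      = (\<integral>x. (\<Prod>T | T \<subseteq> {..<5} \<and> card T = 3. codegree W' T x) \<partial>?P)"
  \<comment> \<open>Vertices are numbered from 1 and residues from 0, hence the shift by
    \<open>Suc\<close> on elements and on triples.\<close>
  proof (rule hom_density_bipartite[where f = "\<lambda>i. Inl (Suc i)" and g = "\<lambda>T. Inr (Suc ` T)",
        OF _ _ _ _ _ _ _ _ assms(4) W' ae])
    have Suc5: "{1..5} = Suc ` {..<5}"
      by (simp add: image_Suc_lessThan)
    have sub: "T \<subseteq> {1..5} \<and> card T = 3 \<longleftrightarrow> (\<exists>T'. T' \<subseteq> {..<5} \<and> card T' = 3 \<and> T = Suc ` T')" for T
      unfolding Suc5 subset_image_iff by (auto simp: card_image)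
    show "verts (subset_incidence_graph 5 3) = (\<lambda>i. Inl (Suc i)) ` {..<5}
        \<union> (\<lambda>T. Inr (Suc ` T)) ` {T. T \<subseteq> {..<5} \<and> card T = 3}"
      unfolding subset_incidence_graph_def sub unfolding Suc5 by auto
    show "edges (subset_incidence_graph 5 3)
        = {{Inl (Suc i), Inr (Suc ` T)} | i T. T \<in> {T. T \<subseteq> {..<5} \<and> card T = 3} \<and> i \<in> T}"
    proof -
      have "edges (subset_incidence_graph 5 3)
          = {{Inl a, Inr T} | a T. a \<in> T \<and> T \<subseteq> {1..5} \<and> card T = 3}"
        unfolding subset_incidence_graph_def ugraph.simps by blast
      then show ?thesis
        unfolding sub by blast
    qed
  qed (auto simp: inj_on_def inj_image_eq_iff)
  define p q where "p x = (\<Prod>j<5. codegree W' (cyclic_triple j) x)"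
    and "q x = (\<Prod>j<5. codegree W' (double5 ` cyclic_triple j) x)" for x
  have meas: "p \<in> borel_measurable ?P" "q \<in> borel_measurable ?P"
    unfolding p_def q_def
    by (intro borel_measurable_prod codegree_borel_measurable[OF W'(1)] cyclic_triple_subset double5_cyclic_triple_subset)+
  have "\<bar>codegree W' T x\<bar> \<le> 1" for T :: "nat set" and x
    using codegree_bounds[of W' T x, OF W'(2,3)] by simp
  then have bounds: "\<bar>p x\<bar> \<le> 1" "\<bar>q x\<bar> \<le> 1" for x
    unfolding p_def q_def abs_prod by (auto intro!: prod_le_1)
  \<comment> \<open>Restricting the permuted point to \<open>{..<5}\<close> changes no codegree, as
    the triples lie in that set, and yields the form that the change of coordinates
    requires.\<close>
  have q_eq: "q x = p (\<lambda>i\<in>{..<5}. x (double5 i))" for x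
    unfolding p_def q_def
  proof (intro prod.cong refl)
    fix j :: nat
    have "codegree W' (double5 ` cyclic_triple j) x = codegree W' (cyclic_triple j) (\<lambda>i. x (double5 i))"
      by (rule codegree_image[OF inj_on_subset[OF inj_on_double5 cyclic_triple_subset]])
    also have "\<dots> = codegree W' (cyclic_triple j) (\<lambda>i\<in>{..<5}. x (double5 i))"
      using cyclic_triple_subset[of j] by (intro codegree_cong) auto
    finally show "codegree W' (double5 ` cyclic_triple j) x = \<dots>" .
  qed
  have int: "integrable ?P (\<lambda>x. a x * b x)"
    if "a \<in> borel_measurable ?P" "b \<in> borel_measurable ?P" "\<And>x. \<bar>a x\<bar> \<le> 1" "\<And>x. \<bar>b x\<bar> \<le> 1"
    for a b :: "(nat \<Rightarrow> real) \<Rightarrow> real"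
  proof (rule unit_cube.P.integrable_const_bound[where B = 1])
    show "AE x in ?P. norm (a x * b x) \<le> 1"
      using that by (simp add: abs_mult mult_le_one)
  qed (use that in simp)
  have "(\<integral>x. p x * q x \<partial>?P) \<le> (\<integral>x. (p x)\<^sup>2 \<partial>?P)"
  proof (rule integral_mult_le_integral_square)
    show "integrable ?P (\<lambda>x. (p x)\<^sup>2)" "integrable ?P (\<lambda>x. (q x)\<^sup>2)" "integrable ?P (\<lambda>x. p x * q x)"
      unfolding power2_eq_square using meas bounds by (intro int; simp)+
    \<comment> \<open>Since \<open>double5\<close> permutes the five coordinates, it preserves the
      measure of the cube.\<close>
    show "(\<integral>x. (q x)\<^sup>2 \<partial>?P) = (\<integral>x. (p x)\<^sup>2 \<partial>?P)"
      unfolding q_eq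
      by (rule integral_unit_cube_reindex[OF inj_on_double5])
         (use double5_image meas in auto)
  qed
  moreover have "(\<Prod>j\<in>{..<5} \<times> (UNIV :: bool set). codegree W' (cyclic_triple (fst j)) x) = (p x)\<^sup>2" for x
  proof -
    have "(\<Prod>j\<in>{..<5} \<times> (UNIV :: bool set). codegree W' (cyclic_triple (fst j)) x)
        = (\<Prod>j<5. \<Prod>k\<in>(UNIV :: bool set). codegree W' (cyclic_triple j) x)"
      by (simp only: prod.cartesian_product case_prod_unfold)
    then show ?thesis
      by (simp add: p_def prod_power_distrib)
  qed
  ultimately show ?thesis
    unfolding M2 F prod_triples p_def q_def by simp
qed

end
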